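(* Let $S$ be a string of length $n$ over an alphabet $\Sigma$ and let $d$ be the maximum number of times a letter appears in $S$. Given positive weights $w_x(\ell)$ for all $x\in\Sigma$ and $\ell\leq d$, a maximum weight letter-duplicated subsequence of $S$ (Weighted-LDS) can be computed in $O(n^2)$ time.
   Context: A subsequence of $S$ is a letter-duplicated subsequence (LDS) if it has the form $x_1^{d_1}x_2^{d_2}\cdots x_k^{d_k}$ with $x_i\in\Sigma$, $x_j\neq x_{j+1}$ and $d_i\geq 2$ for all $i\in[k]$, $j\in[k-1]$; each $x_i^{d_i}$ is an LD-block. The weight of the LD-block $x^\ell$ is $w_x(\ell)$, an arbitrary positive function of $x$ and $\ell$ (not necessarily increasing in $\ell$), and the weight of an LDS is the sum of the weights of its LD-blocks. There is no requirement that all letters of $\Sigma$ appear. *)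

theory Defs
  imports Complex_Main "HOL-Library.Sublist" "HOL-Library.Landau_Symbols"
begin

section \<open>Letter-duplicated subsequences\<close>

text \<open>
  A list of blocks \<open>[(x\<^sub>1, d\<^sub>1), \<dots>, (x\<^sub>k, d\<^sub>k)]\<close> stands for the word
  \<open>x\<^sub>1\<^bsup>d\<^sub>1\<^esup> \<dots> x\<^sub>k\<^bsup>d\<^sub>k\<^esup>\<close>. Since neighbouring letters differ and all exponents are positive, an LDS
  determines its LD-blocks (lemma \<open>LD_blocks_unique\<close>). The empty word (\<open>k = 0\<close>) is an LDS.
\<close>

definition block_word :: "('a \<times> nat) list \<Rightarrow> 'a list" where
  "block_word bs = concat (map (\<lambda>(x, d). replicate d x) bs)"

definition LD_blocks :: "('a \<times> nat) list \<Rightarrow> bool" where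
  "LD_blocks bs \<longleftrightarrow> (\<forall>(x, d) \<in> set bs. 2 \<le> d) \<and> distinct_adj (map fst bs)"

definition LDS :: "'a list \<Rightarrow> ('a \<times> nat) list \<Rightarrow> bool" where
  "LDS S bs \<longleftrightarrow> LD_blocks bs \<and> subseq (block_word bs) S"

definition LDS_weight :: "('a \<Rightarrow> nat \<Rightarrow> real) \<Rightarrow> ('a \<times> nat) list \<Rightarrow> real" where
  "LDS_weight w bs = (\<Sum>(x, d) \<leftarrow> bs. w x d)"

definition max_weight_LDS :: "('a \<Rightarrow> nat \<Rightarrow> real) \<Rightarrow> 'a list \<Rightarrow> ('a \<times> nat) list \<Rightarrow> bool" where
  "max_weight_LDS w S bs \<longleftrightarrow>
     LDS S bs \<and> (\<forall>bs'. LDS S bs' \<longrightarrow> LDS_weight w bs' \<le> LDS_weight w bs)"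

definition max_occ :: "'a list \<Rightarrow> nat" where
  "max_occ S = Max (insert 0 (count_list S ` set S))"

lemma LD_blocks_unique:
  assumes "LD_blocks bs" "LD_blocks bs'" "block_word bs = block_word bs'"
  shows "bs = bs'"
  using assms
proof (induction bs arbitrary: bs')
  case Nil
  then show ?case
    by (cases bs') (auto simp: LD_blocks_def block_word_def)
next
  case (Cons b bs)
  obtain x d where b: "b = (x, d)" by (cases b)
  have d: "2 \<le> d" using Cons.prems(1) by (simp add: LD_blocks_def b)
  obtain b' cs where bs': "bs' = b' # cs"
    using Cons.prems(3) d by (cases bs') (auto simp: block_word_def b)
  obtain y e where b': "b' = (y, e)" by (cases b')
  have e: "2 \<le> e" using Cons.prems(2) by (simp add: LD_blocks_def bs' b')
  have run: "takeWhile ((=) z) (block_word ((z, k) # rs)) = replicate k z \<and>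
             dropWhile ((=) z) (block_word ((z, k) # rs)) = block_word rs"
    if ld: "LD_blocks ((z, k) # rs)" for z :: 'a and k rs
  proof -
    have "block_word rs = [] \<or> hd (block_word rs) \<noteq> z"
    proof (cases rs)
      case Nil
      then show ?thesis by (simp add: block_word_def)
    next
      case (Cons r rs')
      obtain u m where r: "r = (u, m)" by (cases r)
      obtain m' where "m = Suc m'" "u \<noteq> z"
        using ld Cons r by (cases m) (auto simp: LD_blocks_def)
      then show ?thesis by (simp add: block_word_def Cons r)
    qed
    moreover have "block_word ((z, k) # rs) = replicate k z @ block_word rs"
      by (simp add: block_word_def)
    ultimately show ?thesis
      by (cases "block_word rs") (auto simp: takeWhile_append dropWhile_append)
  qed
  have "hd (block_word (b # bs)) = x"
    using d by (cases d) (simp_all add: block_word_def b)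
  moreover have "hd (block_word bs') = y"
    using e by (cases e) (simp_all add: block_word_def bs' b')
  ultimately have xy: "x = y" using Cons.prems(3) by simp
  have 1: "replicate d x = replicate e x \<and> block_word bs = block_word cs"
    using run[of x d bs] run[of y e cs] Cons.prems by (simp add: b bs' b' xy)
  then have "d = e" by (metis length_replicate)
  moreover have "bs = cs"
    using 1 Cons.IH[of cs] Cons.prems
    by (auto simp: LD_blocks_def bs' dest: distinct_adj_ConsD)
  ultimately show ?case by (simp add: b bs' b' xy)
qed

section \<open>A unit-cost random access machine\<close>

text \<open>
  Structured programs over a random access memory with two sorts of cells, natural numbers (indices,
  counters, letters) and real weights. Every program uses finitely many registers and finitely many
  arrays, which it names by constants; array cells are addressed by the contents of a register.
  There is no multiplication, and weights can only be copied, added and compared.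
  All cells initially hold \<open>0\<close>.

  The input is read-only: the string, and a table of weights that need not be defined everywhere.
  Reading the string or the table outside its domain makes the program get stuck.
\<close>

type_synonym name = nat

record input =
  inp_string :: "nat list"
  inp_weight :: "nat \<Rightarrow> nat \<Rightarrow> real option"

record state =
  reg :: "name \<Rightarrow> nat"
  arr :: "name \<Rightarrow> nat \<Rightarrow> nat"
  wreg :: "name \<Rightarrow> real"
  warr :: "name \<Rightarrow> nat \<Rightarrow> real"
  emitted :: "nat list"

definition init_state :: state where
  "init_state = \<lparr>reg = (\<lambda>_. 0), arr = (\<lambda>_ _. 0), wreg = (\<lambda>_. 0), warr = (\<lambda>_ _. 0), emitted = []\<rparr>"

datatype instr =
    Const name nat
  | Move name name
  | Add name name name
  | Sub name name name
  | Load name name name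
  | Store name name name
  | WMove name name
  | WAdd name name name
  | WLoad name name name
  | WStore name name name
  | Input_Length name
  | Input_Letter name name
  | Input_Weight name name name
  | Emit name

fun exec_instr :: "input \<Rightarrow> instr \<Rightarrow> state \<Rightarrow> state option" where
  "exec_instr I (Const x k) s = Some (s\<lparr>reg := (reg s)(x := k)\<rparr>)"
| "exec_instr I (Move x y) s = Some (s\<lparr>reg := (reg s)(x := reg s y)\<rparr>)"
| "exec_instr I (Add x y z) s = Some (s\<lparr>reg := (reg s)(x := reg s y + reg s z)\<rparr>)"
| "exec_instr I (Sub x y z) s = Some (s\<lparr>reg := (reg s)(x := reg s y - reg s z)\<rparr>)"
| "exec_instr I (Load x a i) s = Some (s\<lparr>reg := (reg s)(x := arr s a (reg s i))\<rparr>)"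
| "exec_instr I (Store a i x) s =
     Some (s\<lparr>arr := (arr s)(a := (arr s a)(reg s i := reg s x))\<rparr>)"
| "exec_instr I (WMove u v) s = Some (s\<lparr>wreg := (wreg s)(u := wreg s v)\<rparr>)"
| "exec_instr I (WAdd u v v') s = Some (s\<lparr>wreg := (wreg s)(u := wreg s v + wreg s v')\<rparr>)"
| "exec_instr I (WLoad u a i) s = Some (s\<lparr>wreg := (wreg s)(u := warr s a (reg s i))\<rparr>)"
| "exec_instr I (WStore a i u) s =
     Some (s\<lparr>warr := (warr s)(a := (warr s a)(reg s i := wreg s u))\<rparr>)"
| "exec_instr I (Input_Length x) s = Some (s\<lparr>reg := (reg s)(x := length (inp_string I))\<rparr>)"
| "exec_instr I (Input_Letter x i) s =
     (if reg s i < length (inp_string I)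
      then Some (s\<lparr>reg := (reg s)(x := inp_string I ! reg s i)\<rparr>) else None)"
| "exec_instr I (Input_Weight u x l) s =
     map_option (\<lambda>r. s\<lparr>wreg := (wreg s)(u := r)\<rparr>) (inp_weight I (reg s x) (reg s l))"
| "exec_instr I (Emit x) s = Some (s\<lparr>emitted := emitted s @ [reg s x]\<rparr>)"

datatype test = Less name name | Equal name name | WLess name name

fun eval_test :: "test \<Rightarrow> state \<Rightarrow> bool" where
  "eval_test (Less x y) s \<longleftrightarrow> reg s x < reg s y"
| "eval_test (Equal x y) s \<longleftrightarrow> reg s x = reg s y"
| "eval_test (WLess u v) s \<longleftrightarrow> wreg s u < wreg s v"

datatype program =
    Skip
  | Instr instr
  | Seq program program
  | If test program program
  | While test program

text \<open>
  \<open>exec I P s t s'\<close>: on input \<open>I\<close>, program \<open>P\<close> started in \<open>s\<close> terminates in \<open>s'\<close> after exactly \<open>t\<close>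
  time units. Instructions and evaluations of tests cost one unit each.
\<close>

inductive exec :: "input \<Rightarrow> program \<Rightarrow> state \<Rightarrow> nat \<Rightarrow> state \<Rightarrow> bool" for I :: input where
  Skip: "exec I Skip s 1 s"
| Instr: "exec_instr I i s = Some s' \<Longrightarrow> exec I (Instr i) s 1 s'"
| Seq: "exec I P s t s' \<Longrightarrow> exec I Q s' t' s'' \<Longrightarrow> exec I (Seq P Q) s (t + t') s''"
| IfTrue: "eval_test b s \<Longrightarrow> exec I P s t s' \<Longrightarrow> exec I (If b P Q) s (Suc t) s'"
| IfFalse: "\<not> eval_test b s \<Longrightarrow> exec I Q s t s' \<Longrightarrow> exec I (If b P Q) s (Suc t) s'"
| WhileFalse: "\<not> eval_test b s \<Longrightarrow> exec I (While b P) s 1 s"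
| WhileTrue: "eval_test b s \<Longrightarrow> exec I P s t s' \<Longrightarrow> exec I (While b P) s' t' s'' \<Longrightarrow>
    exec I (While b P) s (Suc (t + t')) s''"

inductive_cases exec_SkipE: "exec I Skip s t s'"
inductive_cases exec_InstrE: "exec I (Instr i) s t s'"
inductive_cases exec_SeqE: "exec I (Seq P Q) s t s'"
inductive_cases exec_IfE: "exec I (If b P Q) s t s'"
inductive_cases exec_WhileE: "exec I (While b P) s t s'"

lemma exec_deterministic:
  "exec I P s t s' \<Longrightarrow> exec I P s u s'' \<Longrightarrow> u = t \<and> s'' = s'"
proof (induction arbitrary: u s'' rule: exec.induct)
  case (Skip s)
  then show ?case by (auto elim: exec_SkipE)
next
  case (Instr i s s')
  then show ?case by (auto elim: exec_InstrE)
next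
  case (Seq P s t s' Q t' s'')
  from Seq.prems show ?case by (rule exec_SeqE) (use Seq.IH in blast)
next
  case (IfTrue b s P t s' Q)
  from IfTrue.prems show ?case by (rule exec_IfE) (use IfTrue.hyps(1) IfTrue.IH in blast)+
next
  case (IfFalse b s Q t s' P)
  from IfFalse.prems show ?case by (rule exec_IfE) (use IfFalse.hyps(1) IfFalse.IH in blast)+
next
  case (WhileFalse b s P)
  from WhileFalse.prems show ?case by (rule exec_WhileE) (use WhileFalse.hyps in simp_all)
next
  case (WhileTrue b s P t s' t' s'')
  from WhileTrue.prems show ?case
    by (rule exec_WhileE) (use WhileTrue.hyps(1) WhileTrue.IH in blast)+
qed

text \<open>
  The letters of the alphabet \<open>A\<close> are numbered. Only the weights \<open>w x l\<close> for \<open>x \<in> A\<close> and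
  \<open>1 \<le> l \<le> max_occ S\<close> are part of the input.
\<close>

definition LDS_input :: "nat set \<Rightarrow> nat list \<Rightarrow> (nat \<Rightarrow> nat \<Rightarrow> real) \<Rightarrow> input" where
  "LDS_input A S w =
     \<lparr>inp_string = S,
      inp_weight = (\<lambda>x l. if x \<in> A \<and> l \<in> {1..max_occ S} then Some (w x l) else None)\<rparr>"

end

theory Submission
  imports Defs
begin

text \<open>
  Let \<open>E i\<close> be the maximum weight of an LDS whose first block starts at position \<open>i\<close>, and \<open>V i\<close> the
  maximum weight of an LDS that lies after \<open>i\<close> and does not start with the letter \<open>S ! i\<close>. A block
  of length \<open>l\<close> starting at \<open>i\<close> may be taken to end at the \<open>l\<close>-th occurrence of \<open>S ! i\<close> from \<open>i\<close> on.
  Hence \<open>E i\<close> is the maximum of \<open>w (S ! i) l + V p\<close>, where \<open>p\<close> ranges over the later occurrences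
  of \<open>S ! i\<close> and \<open>l\<close> counts the occurrences from \<open>i\<close> to \<open>p\<close>, and \<open>V i\<close> is the maximum of \<open>0\<close> and
  of \<open>E p\<close> over the later positions \<open>p\<close> with \<open>S ! p \<noteq> S ! i\<close>. One scan of the positions after \<open>i\<close>
  computes both, for quadratic time in total. Filling the tables from right to left makes the
  traceback pointers run from left to right, so the blocks are emitted in order.
\<close>

section \<open>The recurrence\<close>

text \<open>No embedding is fixed. For a position \<open>p\<close> of \<open>S\<close>, an LDS of
  the suffix with first letter \<open>S ! p\<close> can always be embedded with that letter at
  \<open>p\<close>.\<close>

definition starts_at :: "'a list \<Rightarrow> nat \<Rightarrow> ('a \<times> nat) list \<Rightarrow> bool" where
  "starts_at S p bs \<longleftrightarrow> LDS (drop p S) bs \<and> bs \<noteq> [] \<and> fst (hd bs) = S ! p"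

text \<open>Here \<open>p\<close> plays the last position of a block: these are the continuations in
  front of which a block of the letter \<open>S ! p\<close> may be put.\<close>

definition avoids :: "'a list \<Rightarrow> nat \<Rightarrow> ('a \<times> nat) list \<Rightarrow> bool" where
  "avoids S p bs \<longleftrightarrow> LDS (drop (Suc p) S) bs \<and> (bs \<noteq> [] \<longrightarrow> fst (hd bs) \<noteq> S ! p)"

definition occ :: "'a list \<Rightarrow> nat \<Rightarrow> nat \<Rightarrow> nat" where
  "occ S i j = count_list (take (j - i) (drop i S)) (S ! i)"

lemma occ_Suc:
  assumes "i \<le> j" "j < length S"
  shows "occ S i (Suc j) = occ S i j + (if S ! j = S ! i then 1 else 0)"
  using assms by (simp add: occ_def Suc_diff_le take_Suc_conv_app_nth)

lemma occ_same [simp]: "occ S i i = 0"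
  by (simp add: occ_def)

text \<open>The scan looks up weights at lengths given by \<open>occ\<close>, so this keeps the
  lookups within the weight table.\<close>

lemma occ_le_max_occ:
  assumes "i < length S"
  shows "occ S i j \<le> max_occ S"
proof -
  have "S = take i S @ take (j - i) (drop i S) @ drop (j - i) (drop i S)"
    by (simp only: append_take_drop_id)
  then have "count_list S (S ! i) = count_list (take i S) (S ! i)
      + (occ S i j + count_list (drop (j - i) (drop i S)) (S ! i))"
    unfolding occ_def by (metis count_list_append)
  then have "occ S i j \<le> count_list S (S ! i)"
    by linarith
  also have "\<dots> \<le> max_occ S"
    unfolding max_occ_def using assms by (intro Max_ge) auto
  finally show ?thesis .
qed

lemma block_word_Nil [simp]: "block_word [] = []"
  by (simp add: block_word_def)

lemma block_word_Cons [simp]: "block_word ((x, d) # bs) = replicate d x @ block_word bs"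
  by (simp add: block_word_def)

lemma LDS_weight_Nil [simp]: "LDS_weight w [] = 0"
  by (simp add: LDS_weight_def)

lemma LDS_weight_Cons [simp]: "LDS_weight w ((x, d) # bs) = w x d + LDS_weight w bs"
  by (simp add: LDS_weight_def)

lemma LDS_Nil [simp]: "LDS S []"
  by (simp add: LDS_def LD_blocks_def)

lemma LD_blocks_Cons:
  "LD_blocks ((x, d) # bs) \<longleftrightarrow> 2 \<le> d \<and> (bs \<noteq> [] \<longrightarrow> fst (hd bs) \<noteq> x) \<and> LD_blocks bs"
  by (cases bs) (auto simp: LD_blocks_def)

lemma LDS_subseq: "LDS S bs \<Longrightarrow> subseq S S' \<Longrightarrow> LDS S' bs"
  by (auto simp: LDS_def intro: subseq_order.trans)

lemma subseq_drop_le: "i \<le> j \<Longrightarrow> subseq (drop j S) (drop i S)"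
  by (metis add.commute drop_drop le_add_diff_inverse2 suffix_drop suffix_imp_subseq)

section \<open>Greedy embedding of blocks\<close>

lemma subseq_replicate_count_list: "subseq (replicate (count_list zs x) x) zs"
  by (induction zs) auto

text \<open>Greedy embedding: each copy of \<open>x\<close> takes the next free occurrence, so the
  last copy lands on occurrence number \<open>Suc l\<close>. No other choice leaves a longer suffix
  for \<open>ys\<close>.\<close>

lemma subseq_replicate_append_split:
  assumes "subseq (replicate (Suc l) x @ ys) zs"
  shows "\<exists>p < length zs. zs ! p = x \<and> count_list (take (Suc p) zs) x = Suc l \<and>
           subseq ys (drop (Suc p) zs)"
  using assms
proof (induction zs arbitrary: l rule: list.induct)
  case Nil
  then show ?case by simp
next
  case (Cons z zs)
  show ?case
  proof (cases "z = x \<and> l = 0")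
    case True
    with Cons.prems show ?thesis by (intro exI[of _ 0]) auto
  next
    case False
    \<comment> \<open>After \<open>z\<close> is read, \<open>Suc l'\<close> copies of
      \<open>x\<close> remain; the excluded case is the one where none would remain.\<close>
    define l' where "l' = (if z = x then l - 1 else l)"
    have "subseq (replicate (Suc l') x @ ys) zs"
      using Cons.prems False by (cases l) (auto simp: l'_def split: if_splits)
    from Cons.IH[OF this] obtain p where "p < length zs" "zs ! p = x"
      "count_list (take (Suc p) zs) x = Suc l'" "subseq ys (drop (Suc p) zs)"
      by blast
    with False show ?thesis by (intro exI[of _ "Suc p"]) (auto simp: l'_def)
  qed
qed

lemma starts_at_split:
  assumes "starts_at S i ((x, l) # bs)"
  shows "x = S ! i \<and> (\<exists>p. i < p \<and> p < length S \<and> S ! p = S ! i \<and> l = occ S i (Suc p) \<and> avoids S p bs)"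
proof -
  have x: "x = S ! i" and l: "2 \<le> l" and bs: "LD_blocks bs" "bs \<noteq> [] \<longrightarrow> fst (hd bs) \<noteq> x"
    and sub: "subseq (replicate (Suc (l - 1)) x @ block_word bs) (drop i S)"
    using assms by (auto simp: starts_at_def LDS_def LD_blocks_Cons)
  from subseq_replicate_append_split[OF sub] obtain p where p: "p < length (drop i S)"
    "drop i S ! p = x" "count_list (take (Suc p) (drop i S)) x = l"
    "subseq (block_word bs) (drop (Suc p) (drop i S))"
    using l by auto
  \<comment> \<open>For \<open>p = 0\<close> the prefix would hold at most one copy of
    \<open>x\<close>, but \<open>l\<close> is at least 2.\<close>
  have "0 < p"
    using p(3) l by (cases "drop i S"; cases p) (auto split: if_splits)
  with p x bs show ?thesis
    by (intro conjI exI[of _ "i + p"])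
      (auto simp: occ_def avoids_def LDS_def add.commute)
qed

lemma LDS_drop_imp_starts_at:
  assumes "LDS (drop k S) bs" "bs \<noteq> []"
  shows "\<exists>p. k \<le> p \<and> p < length S \<and> starts_at S p bs"
proof -
  obtain y l bs' where bs: "bs = (y, l) # bs'"
    using assms(2) by (metis neq_Nil_conv surj_pair)
  have l: "2 \<le> l" and LD: "LD_blocks bs"
    using assms by (auto simp: LDS_def bs LD_blocks_Cons)
  then have word: "block_word bs = y # replicate (l - 1) y @ block_word bs'"
    by (cases l) (auto simp: bs)
  \<comment> \<open>Only one copy of \<open>y\<close> is split off, to place the first letter; the
    rest of its block stays with the later blocks.\<close>
  then have sub: "subseq (replicate (Suc 0) y @ replicate (l - 1) y @ block_word bs') (drop k S)"
    using assms by (simp add: LDS_def)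
  from subseq_replicate_append_split[OF sub] obtain q where q: "q < length S - k"
    "drop k S ! q = y"
    "subseq (replicate (l - 1) y @ block_word bs') (drop (Suc q) (drop k S))"
    by auto
  define p where "p = k + q"
  have p: "k \<le> p" "p < length S" "S ! p = y"
    using q by (auto simp: p_def)
  have "subseq (replicate (l - 1) y @ block_word bs') (drop (Suc p) S)"
    using q(3) by (simp add: p_def add.commute)
  then have "subseq (block_word bs) (drop p S)"
    using p by (simp add: word flip: Cons_nth_drop_Suc)
  then have "starts_at S p bs"
    using LD p by (simp add: starts_at_def LDS_def bs)
  with p show ?thesis by blast
qed

lemma avoids_imp_starts_at:
  assumes "avoids S i bs" "bs \<noteq> []"
  shows "\<exists>p. i < p \<and> p < length S \<and> S ! p \<noteq> S ! i \<and> starts_at S p bs"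
proof -
  have "LDS (drop (Suc i) S) bs" "fst (hd bs) \<noteq> S ! i"
    using assms by (auto simp: avoids_def)
  with LDS_drop_imp_starts_at[of "Suc i" S bs] assms(2) show ?thesis
    by (auto simp: starts_at_def Suc_le_eq)
qed

lemma starts_at_Cons:
  assumes "i < p" "p < length S" "S ! p = S ! i" "avoids S p bs"
  shows "starts_at S i ((S ! i, occ S i (Suc p)) # bs)"
proof -
  have "occ S i (Suc i) = 1"
    using assms by (simp add: occ_Suc)
  \<comment> \<open>Position \<open>i\<close> gives one occurrence before \<open>p\<close>, and
    \<open>p\<close> itself gives another, hence an exponent of at least 2.\<close>
  moreover have "occ S i (Suc i) \<le> occ S i p"
    using Suc_leI[OF assms(1)] assms(2)
  proof (induction p rule: dec_induct)
    case (step n)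
    then show ?case by (simp add: occ_Suc)
  qed auto
  ultimately have 2: "2 \<le> occ S i (Suc p)"
    using assms by (simp add: occ_Suc)
  have "drop i S = take (Suc p - i) (drop i S) @ drop (Suc p) S"
    using assms(1) by (metis append_take_drop_id drop_drop le_add_diff_inverse2 less_imp_le le_SucI)
  moreover have "subseq (replicate (occ S i (Suc p)) (S ! i)) (take (Suc p - i) (drop i S))"
    unfolding occ_def by (rule subseq_replicate_count_list)
  ultimately have "subseq (replicate (occ S i (Suc p)) (S ! i) @ block_word bs) (drop i S)"
    using assms(4) by (metis LDS_def avoids_def list_emb_append_mono)
  with 2 assms show ?thesis
    by (auto simp: starts_at_def avoids_def LDS_def LD_blocks_Cons)
qed

lemma starts_at_imp_avoids:
  "i < p \<Longrightarrow> S ! p \<noteq> S ! i \<Longrightarrow> starts_at S p bs \<Longrightarrow> avoids S i bs"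
  using LDS_subseq[OF _ subseq_drop_le[of "Suc i" p S]] by (auto simp: starts_at_def avoids_def)

section \<open>Dynamic programming tables\<close>

text \<open>
  Pointers are shifted by one, so that \<open>0\<close> is the null pointer: \<open>Suc i\<close> refers to the solution whose
  first block has length \<open>g i\<close> and ranges over the positions from \<open>i\<close> to \<open>f i\<close>; the next
  block is found at the pointer \<open>h (f i)\<close>.
\<close>

inductive trace ::
  "'a list \<Rightarrow> nat \<Rightarrow> (nat \<Rightarrow> nat) \<Rightarrow> (nat \<Rightarrow> nat) \<Rightarrow> (nat \<Rightarrow> nat) \<Rightarrow> nat \<Rightarrow> ('a \<times> nat) list \<Rightarrow> bool"
  for S m f g h where
  Nil: "trace S m f g h 0 []"
| Cons: "m \<le> i \<Longrightarrow> i < length S \<Longrightarrow> m \<le> f i \<Longrightarrow> trace S m f g h (h (f i)) bs \<Longrightarrow>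
    trace S m f g h (Suc i) ((S ! i, g i) # bs)"

text \<open>A trace with bound \<open>m\<close> reads the tables only at indices from
  \<open>m\<close> on, so it survives writes at smaller indices.\<close>

lemma trace_cong:
  assumes "trace S m f g h k bs" "m' \<le> m"
    "\<And>p. m \<le> p \<Longrightarrow> f' p = f p" "\<And>p. m \<le> p \<Longrightarrow> g' p = g p" "\<And>p. m \<le> p \<Longrightarrow> h' p = h p"
  shows "trace S m' f' g' h' k bs"
  using assms(1)
proof induction
  case (Cons i bs)
  then show ?case
    using trace.Cons[of m' i S f' g' h' bs] assms(2-) by auto
qed (rule trace.Nil)

text \<open>\<open>E p\<close> is \<open>0\<close> if no LD-block starts at \<open>p\<close>.\<close>

definition tables_ok ::
  "'a list \<Rightarrow> ('a \<Rightarrow> nat \<Rightarrow> real) \<Rightarrow> nat \<Rightarrow> (nat \<Rightarrow> real) \<Rightarrow> (nat \<Rightarrow> real) \<Rightarrow>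
   (nat \<Rightarrow> nat) \<Rightarrow> (nat \<Rightarrow> nat) \<Rightarrow> (nat \<Rightarrow> nat) \<Rightarrow> bool" where
  "tables_ok S w m E V f g h \<longleftrightarrow> (\<forall>p. m \<le> p \<and> p < length S \<longrightarrow>
     (\<forall>bs. starts_at S p bs \<longrightarrow> LDS_weight w bs \<le> E p) \<and>
     (0 < E p \<longrightarrow> (\<exists>bs. starts_at S p bs \<and> trace S m f g h (Suc p) bs \<and> LDS_weight w bs = E p)) \<and>
     (\<forall>bs. avoids S p bs \<longrightarrow> LDS_weight w bs \<le> V p) \<and>
     (\<exists>bs. avoids S p bs \<and> trace S m f g h (h p) bs \<and> LDS_weight w bs = V p))"

text \<open>Inner loop invariant: \<open>e\<close> and \<open>v\<close> are the running maxima for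
  \<open>E i\<close> and \<open>V i\<close>, and \<open>pe\<close>, \<open>pl\<close>,
  \<open>pv\<close> record where they are attained. As long as \<open>e\<close> is 0, nothing is
  claimed about \<open>pe\<close> and \<open>pl\<close>.\<close>

definition scanned ::
  "'a list \<Rightarrow> ('a \<Rightarrow> nat \<Rightarrow> real) \<Rightarrow> (nat \<Rightarrow> real) \<Rightarrow> (nat \<Rightarrow> real) \<Rightarrow>
   nat \<Rightarrow> nat \<Rightarrow> real \<Rightarrow> nat \<Rightarrow> nat \<Rightarrow> real \<Rightarrow> nat \<Rightarrow> bool" where
  "scanned S w E V i j e pe pl v pv \<longleftrightarrow>
     (\<forall>p. i < p \<and> p < j \<longrightarrow>
        (if S ! p = S ! i then w (S ! i) (occ S i (Suc p)) + V p \<le> e else E p \<le> v)) \<and>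
     (0 < e \<longrightarrow> i < pe \<and> pe < j \<and> S ! pe = S ! i \<and> pl = occ S i (Suc pe) \<and>
        e = w (S ! i) pl + V pe) \<and>
     0 \<le> v \<and>
     (v = 0 \<and> pv = 0 \<or>
       0 < v \<and> (\<exists>p. pv = Suc p \<and> i < p \<and> p < j \<and> S ! p \<noteq> S ! i \<and> v = E p))"

text \<open>Running maximum of the outer loop; the value 0 with the null pointer stands for the
  empty LDS.\<close>

definition best_from ::
  "nat \<Rightarrow> (nat \<Rightarrow> real) \<Rightarrow> nat \<Rightarrow> real \<Rightarrow> nat \<Rightarrow> bool" where
  "best_from n E i b pb \<longleftrightarrow> (\<forall>p. i \<le> p \<and> p < n \<longrightarrow> E p \<le> b) \<and>
     (b = 0 \<and> pb = 0 \<or> 0 < b \<and> (\<exists>p. pb = Suc p \<and> i \<le> p \<and> p < n \<and> b = E p))"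

section \<open>Extending the tables by one position\<close>

lemma scanned_init: "scanned S w E V i (Suc i) 0 pe pl 0 0"
  by (simp add: scanned_def)

lemma scanned_same:
  assumes "scanned S w E V i j e pe pl v pv" "i < j" "S ! j = S ! i"
    "u = w (S ! i) (occ S i (Suc j)) + V j"
  shows "e < u \<Longrightarrow> scanned S w E V i (Suc j) u j (occ S i (Suc j)) v pv"
    and "\<not> e < u \<Longrightarrow> scanned S w E V i (Suc j) e pe pl v pv"
  using assms unfolding scanned_def by (fastforce simp: less_Suc_eq)+

lemma scanned_other:
  assumes "scanned S w E V i j e pe pl v pv" "i < j" "S ! j \<noteq> S ! i"
  shows "v < E j \<Longrightarrow> scanned S w E V i (Suc j) e pe pl (E j) (Suc j)"
    and "\<not> v < E j \<Longrightarrow> scanned S w E V i (Suc j) e pe pl v pv"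
  using assms unfolding scanned_def by (fastforce simp: less_Suc_eq)+

text \<open>Upper bounds come from cutting off the first block (\<open>starts_at_split\<close>) or
  locating its start (\<open>avoids_imp_starts_at\<close>). Attainment comes from putting a block
  before the solution stored for \<open>pe\<close>, or reusing the one that \<open>pv\<close> points
  to.\<close>

lemma tables_ok_step:
  assumes ok: "tables_ok S w (Suc i) E V f g h" and i: "i < length S"
    and sc: "scanned S w E V i (length S) e pe pl v pv"
  shows "tables_ok S w i (E(i := e)) (V(i := v)) (f(i := pe)) (g(i := pl)) (h(i := pv))"
    (is "tables_ok S w i ?E ?V ?f ?g ?h")
proof -
  let ?x = "S ! i"
  note okD = ok[unfolded tables_ok_def, rule_format]
  have tr: "trace S i ?f ?g ?h k bs" if "trace S (Suc i) f g h k bs" for k bs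
    using that by (rule trace_cong) auto
  have e_ub: "LDS_weight w bs \<le> e" if bs: "starts_at S i bs" for bs
  proof -
    obtain x l bs' where bs': "bs = (x, l) # bs'"
      using bs by (metis neq_Nil_conv surj_pair starts_at_def)
    from starts_at_split[OF bs[unfolded bs']] obtain p where p: "x = ?x" "i < p" "p < length S"
      "S ! p = ?x" "l = occ S i (Suc p)" "avoids S p bs'"
      by blast
    have "LDS_weight w bs' \<le> V p"
      using okD[of p] p by auto
    moreover have "w ?x l + V p \<le> e"
      using sc p unfolding scanned_def by auto
    ultimately show ?thesis
      using p(1) by (simp add: bs')
  qed
  have e_att: "\<exists>bs. starts_at S i bs \<and> trace S i ?f ?g ?h (Suc i) bs \<and> LDS_weight w bs = e"
    if "0 < e"
  proof -
    have pe: "i < pe" "pe < length S" "S ! pe = ?x" "pl = occ S i (Suc pe)"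
      "e = w ?x pl + V pe"
      using sc that unfolding scanned_def by auto
    obtain bs where bs: "avoids S pe bs" "trace S (Suc i) f g h (h pe) bs" "LDS_weight w bs = V pe"
      using okD[of pe] pe by auto
    have "trace S i ?f ?g ?h (Suc i) ((?x, ?g i) # bs)"
      using pe i tr[OF bs(2)] by (intro trace.Cons) auto
    moreover have "starts_at S i ((?x, pl) # bs)"
      unfolding pe(4) using pe bs by (intro starts_at_Cons)
    ultimately show ?thesis
      using bs(3) pe(5) by (intro exI[of _ "(?x, pl) # bs"]) simp
  qed
  have v_ub: "LDS_weight w bs \<le> v" if bs: "avoids S i bs" for bs
  proof (cases "bs = []")
    case True
    then show ?thesis using sc by (simp add: scanned_def)
  next
    case False
    from avoids_imp_starts_at[OF bs this] obtain p where p: "i < p" "p < length S" "S ! p \<noteq> ?x"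
      "starts_at S p bs"
      by blast
    have "LDS_weight w bs \<le> E p"
      using okD[of p] p by auto
    also have "\<dots> \<le> v"
      using sc p unfolding scanned_def by auto
    finally show ?thesis .
  qed
  have v_att: "\<exists>bs. avoids S i bs \<and> trace S i ?f ?g ?h pv bs \<and> LDS_weight w bs = v"
  proof (cases "pv = 0")
    case True
    then show ?thesis
      using sc by (intro exI[of _ "[]"]) (auto simp: scanned_def avoids_def trace.Nil)
  next
    case False
    then obtain p where p: "pv = Suc p" "i < p" "p < length S" "S ! p \<noteq> ?x" "v = E p" "0 < v"
      using sc unfolding scanned_def by auto
    then obtain bs where "starts_at S p bs" "trace S (Suc i) f g h (Suc p) bs"
      "LDS_weight w bs = E p"
      using okD[of p] by auto
    with p show ?thesis
      using starts_at_imp_avoids tr by blast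
  qed
  show ?thesis
    unfolding tables_ok_def
  proof (intro allI impI)
    fix p
    assume p: "i \<le> p \<and> p < length S"
    show "(\<forall>bs. starts_at S p bs \<longrightarrow> LDS_weight w bs \<le> ?E p) \<and>
      (0 < ?E p \<longrightarrow>
        (\<exists>bs. starts_at S p bs \<and> trace S i ?f ?g ?h (Suc p) bs \<and> LDS_weight w bs = ?E p)) \<and>
      (\<forall>bs. avoids S p bs \<longrightarrow> LDS_weight w bs \<le> ?V p) \<and>
      (\<exists>bs. avoids S p bs \<and> trace S i ?f ?g ?h (?h p) bs \<and> LDS_weight w bs = ?V p)"
    proof (cases "p = i")
      case True
      then show ?thesis using e_ub e_att v_ub v_att by simp
    next
      case False
      then have "Suc i \<le> p \<and> p < length S" using p by auto
      with okD[OF this] False tr show ?thesis by (simp del: fun_upd_apply add: fun_upd_other) blast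
    qed
  qed
qed

lemma best_from_step:
  assumes "best_from n E (Suc i) b pb" "i < n"
  shows "b < e \<Longrightarrow> best_from n (E(i := e)) i e (Suc i)"
    and "\<not> b < e \<Longrightarrow> best_from n (E(i := e)) i b pb"
proof -
  have *: "i \<le> p \<longleftrightarrow> p = i \<or> Suc i \<le> p" for p
    by linarith
  show "b < e \<Longrightarrow> best_from n (E(i := e)) i e (Suc i)"
    using assms unfolding best_from_def * by auto
  show "\<not> b < e \<Longrightarrow> best_from n (E(i := e)) i b pb"
    using assms unfolding best_from_def * by auto
qed

text \<open>Every nonempty LDS starts at some position, so the maximum of 0 and the entries of
  \<open>E\<close> is the global optimum.\<close>

lemma max_weight_LDS_trace:
  assumes ok: "tables_ok S w 0 E V f g h" and b: "best_from (length S) E 0 b pb"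
  shows "\<exists>bs. max_weight_LDS w S bs \<and> trace S 0 f g h pb bs"
proof -
  note okD = ok[unfolded tables_ok_def, rule_format]
  have "\<exists>bs. LDS S bs \<and> trace S 0 f g h pb bs \<and> LDS_weight w bs = b"
  proof (cases "pb = 0")
    case True
    then show ?thesis
      using b by (intro exI[of _ "[]"]) (auto simp: best_from_def trace.Nil)
  next
    case False
    then obtain p where p: "pb = Suc p" "p < length S" "b = E p" "0 < b"
      using b unfolding best_from_def by auto
    then obtain bs where "starts_at S p bs" "trace S 0 f g h pb bs" "LDS_weight w bs = b"
      using okD[of p] by auto
    then show ?thesis
      using LDS_subseq[OF _ subseq_drop_le[of 0 p S]] by (auto simp: starts_at_def)
  qed
  moreover have "LDS_weight w bs \<le> b" if "LDS S bs" for bs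
  proof (cases "bs = []")
    case True
    then show ?thesis using b by (auto simp: best_from_def)
  next
    case False
    with that obtain p where "p < length S" "starts_at S p bs"
      using LDS_drop_imp_starts_at[of 0] by auto
    then have "LDS_weight w bs \<le> E p"
      using okD[of p] by simp
    also have "E p \<le> b"
      using \<open>p < length S\<close> b by (simp add: best_from_def)
    finally show ?thesis .
  qed
  ultimately show ?thesis
    unfolding max_weight_LDS_def by blast
qed

section \<open>Timed weakest preconditions\<close>

text \<open>\<open>c\<close> is the time elapsed before \<open>P\<close> is started; the postcondition sees the total time.\<close>

definition run :: "input \<Rightarrow> program \<Rightarrow> nat \<Rightarrow> state \<Rightarrow> (nat \<Rightarrow> state \<Rightarrow> bool) \<Rightarrow> bool" where
  "run I P c s Q \<longleftrightarrow> (\<exists>t s'. exec I P s t s' \<and> Q (c + t) s')"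

lemma run_mono: "run I P c s Q \<Longrightarrow> (\<And>c s. Q c s \<Longrightarrow> Q' c s) \<Longrightarrow> run I P c s Q'"
  by (auto simp: run_def)

lemma run_Skip: "run I Skip c s Q \<longleftrightarrow> Q (Suc c) s"
  unfolding run_def by (metis Suc_eq_plus1 exec.Skip exec_SkipE)

lemma run_Instr:
  "run I (Instr i) c s Q \<longleftrightarrow> (\<exists>s'. exec_instr I i s = Some s' \<and> Q (Suc c) s')"
  unfolding run_def by (metis Suc_eq_plus1 exec.Instr exec_InstrE)

lemma run_Seq: "run I (Seq P P') c s Q \<longleftrightarrow> run I P c s (\<lambda>c' s'. run I P' c' s' Q)"
proof
  assume "run I (Seq P P') c s Q"
  then obtain t s'' where "exec I (Seq P P') s t s''" "Q (c + t) s''"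
    by (auto simp: run_def)
  then show "run I P c s (\<lambda>c' s'. run I P' c' s' Q)"
    by (auto simp: run_def add.assoc elim!: exec_SeqE)
next
  assume "run I P c s (\<lambda>c' s'. run I P' c' s' Q)"
  then obtain t s' t' s'' where "exec I P s t s'" "exec I P' s' t' s''" "Q (c + (t + t')) s''"
    by (auto simp: run_def add.assoc)
  then show "run I (Seq P P') c s Q"
    unfolding run_def using exec.Seq by blast
qed

lemma run_If: "run I (If b P P') c s Q \<longleftrightarrow> run I (if eval_test b s then P else P') (Suc c) s Q"
proof
  assume "run I (If b P P') c s Q"
  then obtain t s' where "exec I (If b P P') s t s'" "Q (c + t) s'"
    by (auto simp: run_def)
  then show "run I (if eval_test b s then P else P') (Suc c) s Q"
    by (auto simp: run_def elim!: exec_IfE) blast+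
next
  assume "run I (if eval_test b s then P else P') (Suc c) s Q"
  then obtain t s' where "exec I (if eval_test b s then P else P') s t s'" "Q (c + Suc t) s'"
    by (auto simp: run_def)
  then show "run I (If b P P') c s Q"
    unfolding run_def using exec.IfTrue exec.IfFalse by (cases "eval_test b s") fastforce+
qed

lemmas run_simps = run_Skip run_Instr run_Seq run_If

text \<open>The decreasing number \<open>m\<close> gives termination. Since the invariant also sees
  the elapsed time, it can relate the time spent to the iterations left.\<close>

lemma run_While:
  fixes m :: nat
  assumes "Inv m c s"
    and body: "\<And>m c s. Inv m c s \<Longrightarrow> eval_test b s \<Longrightarrow>
      run I P (Suc c) s (\<lambda>c' s'. \<exists>m' < m. Inv m' c' s')"
    and exit: "\<And>m c s. Inv m c s \<Longrightarrow> \<not> eval_test b s \<Longrightarrow> Q (Suc c) s"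
  shows "run I (While b P) c s Q"
  using assms(1)
proof (induction m arbitrary: c s rule: less_induct)
  case (less m)
  show ?case
  proof (cases "eval_test b s")
    case True
    from body[OF less.prems True] obtain t s' m' where step: "exec I P s t s'" "m' < m"
      "Inv m' (Suc c + t) s'"
      unfolding run_def by blast
    from less.IH[OF step(2,3)] obtain t' s'' where
      "exec I (While b P) s' t' s''" "Q (Suc c + t + t') s''"
      unfolding run_def by blast
    with exec.WhileTrue[OF True step(1)] show ?thesis
      unfolding run_def by (metis add.assoc add_Suc add_Suc_right)
  next
    case False
    with exit[OF less.prems] show ?thesis
      unfolding run_def by (metis exec.WhileFalse Suc_eq_plus1)
  qed
qed

text \<open>The singleton case avoids a trailing \<open>Skip\<close>, which would cost a time
  unit.\<close>

fun seq :: "program list \<Rightarrow> program" where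
  "seq [] = Skip"
| "seq [P] = P"
| "seq (P # Q # Ps) = Seq P (seq (Q # Ps))"

section \<open>The program\<close>

text \<open>
  The name \<open>1\<close> is avoided, since the simplifier turns it into \<open>Suc 0\<close>. The registers \<open>rZero\<close> and
  \<open>wZero\<close> are never written and keep their initial value \<open>0\<close>. The arrays \<open>aE\<close>, \<open>aV\<close>, \<open>aF\<close>, \<open>aG\<close>,
  \<open>aH\<close> hold the tables \<open>E\<close>, \<open>V\<close>, \<open>f\<close>, \<open>g\<close>, \<open>h\<close>.
\<close>

abbreviation (input) "rZero \<equiv> 0 :: name"
abbreviation (input) "rOne \<equiv> 12 :: name"
abbreviation (input) "rN \<equiv> 2 :: name"
abbreviation (input) "rI \<equiv> 3 :: name"
abbreviation (input) "rJ \<equiv> 4 :: name"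
abbreviation (input) "rX \<equiv> 5 :: name"
abbreviation (input) "rY \<equiv> 6 :: name"
abbreviation (input) "rC \<equiv> 7 :: name"
abbreviation (input) "rPe \<equiv> 8 :: name"
abbreviation (input) "rPl \<equiv> 9 :: name"
abbreviation (input) "rPv \<equiv> 10 :: name"
abbreviation (input) "rPb \<equiv> 11 :: name"

abbreviation (input) "wZero \<equiv> 0 :: name"
abbreviation (input) "wE \<equiv> 6 :: name"
abbreviation (input) "wV \<equiv> 2 :: name"
abbreviation (input) "wB \<equiv> 3 :: name"
abbreviation (input) "wU \<equiv> 4 :: name"
abbreviation (input) "wT \<equiv> 5 :: name"

abbreviation (input) "aE \<equiv> 0 :: name"
abbreviation (input) "aV \<equiv> 2 :: name"

abbreviation (input) "aF \<equiv> 0 :: name"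
abbreviation (input) "aG \<equiv> 3 :: name"
abbreviation (input) "aH \<equiv> 2 :: name"

definition scan_body :: program where
  "scan_body = seq
    [Instr (Input_Letter rY rJ),
     If (Equal rY rX)
       (seq
         [Instr (Add rC rC rOne),
          Instr (Input_Weight wU rX rC),
          Instr (WLoad wT aV rJ),
          Instr (WAdd wU wU wT),
          If (WLess wE wU)
            (seq [Instr (WMove wE wU), Instr (Move rPe rJ), Instr (Move rPl rC)])
            Skip])
       (seq
         [Instr (WLoad wU aE rJ),
          If (WLess wV wU)
            (seq [Instr (WMove wV wU), Instr (Add rPv rJ rOne)])
            Skip]),
     Instr (Add rJ rJ rOne)]"

text \<open>The counter \<open>rC\<close> starts at 1 because position \<open>i\<close> is itself an
  occurrence. \<open>rPe\<close> and \<open>rPl\<close> may keep stale values, which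
  \<open>scanned\<close> tolerates while \<open>e\<close> is 0.\<close>

definition fill_body :: program where
  "fill_body = seq
    [Instr (Sub rI rI rOne),
     Instr (Input_Letter rX rI),
     Instr (Const rC 1),
     Instr (WMove wE wZero),
     Instr (WMove wV wZero),
     Instr (Const rPv 0),
     Instr (Add rJ rI rOne),
     While (Less rJ rN) scan_body,
     Instr (WStore aE rI wE),
     Instr (WStore aV rI wV),
     Instr (Store aF rI rPe),
     Instr (Store aG rI rPl),
     Instr (Store aH rI rPv),
     If (WLess wB wE)
       (seq [Instr (WMove wB wE), Instr (Add rPb rI rOne)])
       Skip]"

definition emit_loop :: program where
  "emit_loop = While (Less rZero rPl) (seq [Instr (Emit rX), Instr (Sub rPl rPl rOne)])"

definition output_body :: program where
  "output_body = seq
    [Instr (Sub rJ rPb rOne),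
     Instr (Input_Letter rX rJ),
     Instr (Load rPl aG rJ),
     emit_loop,
     Instr (Load rPe aF rJ),
     Instr (Load rPb aH rPe)]"

definition LDS_program :: program where
  "LDS_program = seq
    [Instr (Input_Length rN),
     Instr (Const rOne 1),
     Instr (Move rI rN),
     While (Less rZero rI) fill_body,
     While (Less rZero rPb) output_body]"

section \<open>Correctness and running time\<close>

lemma run_scan_body:
  assumes I: "I = LDS_input A S w" and A: "set S \<subseteq> A" and i: "i < length S"
    and j: "i < j" "j < length S"
    and s: "reg s rOne = 1" "reg s rX = S ! i" "reg s rC = occ S i j" "reg s rJ = j"
    and sc: "scanned S w (warr s aE) (warr s aV) i j
      (wreg s wE) (reg s rPe) (reg s rPl) (wreg s wV) (reg s rPv)"
  shows "run I scan_body c s (\<lambda>c' s'.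
    c' \<le> c + 11 \<and> reg s' rJ = Suc j \<and> reg s' rC = occ S i (Suc j) \<and>
    scanned S w (warr s aE) (warr s aV) i (Suc j)
      (wreg s' wE) (reg s' rPe) (reg s' rPl) (wreg s' wV) (reg s' rPv) \<and>
    arr s' = arr s \<and> warr s' = warr s \<and> emitted s' = emitted s \<and>
    (\<forall>r \<in> {rZero, rOne, rN, rI, rPb, rX}. reg s' r = reg s r) \<and>
    wreg s' wZero = wreg s wZero \<and> wreg s' wB = wreg s wB)"
proof (cases "S ! j = S ! i")
  case True
  let ?l = "Suc (occ S i j)"
  have l: "occ S i (Suc j) = ?l"
    using True j by (simp add: occ_Suc)
  \<comment> \<open>The lookup is defined: the letter lies in \<open>A\<close>, and the length is at
    least 1 and at most \<open>max_occ S\<close>.\<close>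
  have input: "inp_string I = S" "inp_weight I (S ! i) ?l = Some (w (S ! i) ?l)"
    using occ_le_max_occ[OF i, of "Suc j"] A i l by (auto simp: I LDS_input_def)
  note sc' = scanned_same[OF sc j(1) True refl]
  show ?thesis
  proof (cases "wreg s wE < w (S ! i) ?l + warr s aV j")
    case less: True
    with sc'(1) show ?thesis
      unfolding scan_body_def by (simp add: run_simps s j True input l)
  next
    case not_less: False
    with sc'(2) show ?thesis
      unfolding scan_body_def by (simp add: run_simps s j True input l)
  qed
next
  case False
  have l: "occ S i (Suc j) = occ S i j"
    using False j by (simp add: occ_Suc)
  have input: "inp_string I = S"
    by (simp add: I LDS_input_def)
  note sc' = scanned_other[OF sc j(1) False]
  show ?thesis
  proof (cases "wreg s wV < warr s aE j")
    case less: True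
    with sc'(1) show ?thesis
      unfolding scan_body_def by (simp add: run_simps s j False input l)
  next
    case not_less: False
    with sc'(2) show ?thesis
      unfolding scan_body_def by (simp add: run_simps s j False input l)
  qed
qed

lemma run_scan_loop:
  assumes I: "I = LDS_input A S w" and A: "set S \<subseteq> A" and i: "i < length S"
    and s: "reg s rOne = 1" "reg s rN = length S" "reg s rX = S ! i" "reg s rC = 1"
      "reg s rJ = Suc i" "reg s rPv = 0" "wreg s wE = 0" "wreg s wV = 0"
  shows "run I (While (Less rJ rN) scan_body) c s (\<lambda>c' s'.
    c' \<le> c + 12 * length S + 1 \<and>
    scanned S w (warr s aE) (warr s aV) i (length S)
      (wreg s' wE) (reg s' rPe) (reg s' rPl) (wreg s' wV) (reg s' rPv) \<and>
    arr s' = arr s \<and> warr s' = warr s \<and> emitted s' = emitted s \<and>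
    (\<forall>r \<in> {rZero, rOne, rN, rI, rPb}. reg s' r = reg s r) \<and>
    wreg s' wZero = wreg s wZero \<and> wreg s' wB = wreg s wB)"
\<comment> \<open>A position costs at most 12 units: the loop test and 11 for the longest path
  through the body. The invariant reserves this for each of the \<open>m\<close> positions
  left.\<close>
proof (rule run_While[where m = "length S - Suc i" and
    Inv = "\<lambda>m c' s'. (\<exists>j. i < j \<and> j \<le> length S \<and> m = length S - j \<and> reg s' rJ = j \<and>
      reg s' rC = occ S i j \<and> c' + 12 * m \<le> c + 12 * length S \<and>
      scanned S w (warr s aE) (warr s aV) i j
        (wreg s' wE) (reg s' rPe) (reg s' rPl) (wreg s' wV) (reg s' rPv)) \<and>
      arr s' = arr s \<and> warr s' = warr s \<and> emitted s' = emitted s \<and>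
      (\<forall>r \<in> {rZero, rOne, rN, rI, rPb, rX}. reg s' r = reg s r) \<and>
      wreg s' wZero = wreg s wZero \<and> wreg s' wB = wreg s wB"], goal_cases)
  case 1
  show ?case
    using i s by (simp add: scanned_init occ_Suc)
next
  case (2 m c1 s1)
  have "reg s1 rJ < length S"
    using 2 s by simp
  with 2 obtain j where j: "i < j" "j < length S" "m = length S - j" "reg s1 rJ = j"
    "reg s1 rC = occ S i j" "c1 + 12 * m \<le> c + 12 * length S"
    and sc: "scanned S w (warr s1 aE) (warr s1 aV) i j
        (wreg s1 wE) (reg s1 rPe) (reg s1 rPl) (wreg s1 wV) (reg s1 rPv)"
    by auto
  have s1: "reg s1 rOne = 1" "reg s1 rX = S ! i"
    using 2 s by auto
  have m: "length S - Suc j < m" "m = Suc (length S - Suc j)"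
    using j by auto
  show ?case
  proof (rule run_mono[OF run_scan_body[OF I A i j(1,2) s1 j(5,4) sc]], goal_cases)
    case (1 c2 s2)
    have "c2 + 12 * (length S - Suc j) \<le> c + 12 * length S"
      using 1 j(6) m(2) by linarith
    with 1 2 j(1,2) m(1) show ?case
      by (intro exI[of _ "length S - Suc j"] conjI exI[of _ "Suc j"]) simp_all
  qed
next
  case (3 m c1 s1)
  then have "reg s1 rJ = length S"
    using s by simp
  with 3 show ?case by auto
qed

text \<open>The arbitrary postcondition lets the rule apply in the middle of a symbolic execution. A
  letter costs 3 units: test, output, decrement.\<close>

lemma run_emit_loop:
  assumes "reg s rZero = 0" "reg s rOne = 1"
    and "Q (c + 3 * reg s rPl + 1)
      (s\<lparr>reg := (reg s)(rPl := 0), emitted := emitted s @ replicate (reg s rPl) (reg s rX)\<rparr>)"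
  shows "run I emit_loop c s Q"
proof -
  let ?s = "\<lambda>m. s\<lparr>reg := (reg s)(rPl := m),
    emitted := emitted s @ replicate (reg s rPl - m) (reg s rX)\<rparr>"
  show ?thesis
    unfolding emit_loop_def
  proof (rule run_While[where m = "reg s rPl" and
      Inv = "\<lambda>m c' s'. m \<le> reg s rPl \<and> c' + 3 * m = c + 3 * reg s rPl \<and> s' = ?s m"], goal_cases)
    case 1
    show ?case by simp
  next
    case (2 m c1 s1)
    then obtain k where m: "m = Suc k"
      using assms by (cases m) auto
    obtain d where d: "reg s rPl = Suc k + d"
      using 2 m by (auto dest: le_Suc_ex)
    have "s1 = ?s m"
      using 2 by blast
    with 2 m d assms show ?case
      by (simp add: run_simps) (intro exI[of _ k] conjI state.equality, simp_all add: replicate_append_same)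
  next
    case (3 m c1 s1)
    with assms show ?case by simp
  qed
qed

definition fill_inv :: "nat list \<Rightarrow> (nat \<Rightarrow> nat \<Rightarrow> real) \<Rightarrow> nat \<Rightarrow> state \<Rightarrow> bool" where
  "fill_inv S w i s \<longleftrightarrow>
     reg s rZero = 0 \<and> reg s rOne = 1 \<and> reg s rN = length S \<and> reg s rI = i \<and>
     wreg s wZero = 0 \<and> emitted s = [] \<and>
     tables_ok S w i (warr s aE) (warr s aV) (arr s aF) (arr s aG) (arr s aH) \<and>
     best_from (length S) (warr s aE) i (wreg s wB) (reg s rPb)"

lemma run_fill_body:
  assumes I: "I = LDS_input A S w" and A: "set S \<subseteq> A" and i: "i < length S"
    and inv: "fill_inv S w (Suc i) s"
  shows "run I fill_body c s (\<lambda>c' s'. c' \<le> c + 12 * length S + 16 \<and> fill_inv S w i s')"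
proof -
  have input: "inp_string I = S"
    by (simp add: I LDS_input_def)
  have s: "reg s rZero = 0" "reg s rOne = 1" "reg s rN = length S" "reg s rI = Suc i"
    "wreg s wZero = 0" "emitted s = []"
    and ok: "tables_ok S w (Suc i) (warr s aE) (warr s aV) (arr s aF) (arr s aG) (arr s aH)"
    and best: "best_from (length S) (warr s aE) (Suc i) (wreg s wB) (reg s rPb)"
    using inv by (simp_all add: fill_inv_def)
  show ?thesis
    unfolding fill_body_def
    \<comment> \<open>Outside the scan there are 7 units before it, 5 stores, and at most 3 for the
      final conditional; the scan's last test makes 16.\<close>
    apply (simp add: run_simps input i s)
    apply (rule run_mono[OF run_scan_loop[OF I A i]])
            apply (simp_all add: s)
    using i tables_ok_step[OF ok i] best_from_step[OF best i]
    apply (simp add: fill_inv_def s)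
    done
qed

lemma run_fill_loop:
  assumes I: "I = LDS_input A S w" and A: "set S \<subseteq> A" and inv: "fill_inv S w (length S) s"
  shows "run I (While (Less rZero rI) fill_body) c s
    (\<lambda>c' s'. c' \<le> c + length S * (12 * length S + 17) + 1 \<and> fill_inv S w 0 s')"
proof (rule run_While[where m = "length S" and
    Inv = "\<lambda>i c' s'. i \<le> length S \<and> fill_inv S w i s' \<and>
      c' + i * (12 * length S + 17) \<le> c + length S * (12 * length S + 17)"], goal_cases)
  case 1
  show ?case using inv by simp
next
  case (2 m c1 s1)
  then obtain i where m: "m = Suc i"
    by (cases m) (auto simp: fill_inv_def)
  have "i < length S" "fill_inv S w (Suc i) s1"
    using 2 m by auto
  from run_fill_body[OF I A this] show ?case
  proof (rule run_mono, goal_cases)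
    case (1 c2 s2)
    with 2 m show ?case by (intro exI[of _ i]) simp
  qed
next
  case (3 m c1 s1)
  then have "m = 0"
    by (auto simp: fill_inv_def)
  with 3 show ?case by simp
qed

section \<open>Traceback and total time\<close>

lemma run_output_loop:
  assumes I: "inp_string I = S"
    and s: "reg s rZero = 0" "reg s rOne = 1"
    and tr: "trace S 0 (arr s aF) (arr s aG) (arr s aH) (reg s rPb) bs"
  shows "run I (While (Less rZero rPb) output_body) c s
    (\<lambda>c' s'. c' = c + 7 * length bs + 3 * length (block_word bs) + 1 \<and>
       emitted s' = emitted s @ block_word bs)"
\<comment> \<open>The list \<open>bs'\<close> holds the blocks still to be output. A block costs 7
  units besides its letters: the test, five instructions and the last test of
  \<open>emit_loop\<close>.\<close>
proof (rule run_While[where m = "length bs" and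
    Inv = "\<lambda>m c' s'. \<exists>bs'. m = length bs' \<and>
      trace S 0 (arr s aF) (arr s aG) (arr s aH) (reg s' rPb) bs' \<and>
      emitted s' @ block_word bs' = emitted s @ block_word bs \<and>
      c' + 7 * m + 3 * length (block_word bs') = c + 7 * length bs + 3 * length (block_word bs) \<and>
      arr s' = arr s \<and> reg s' rZero = 0 \<and> reg s' rOne = 1"], goal_cases)
  case 1
  show ?case using s tr by blast
next
  case (2 m c1 s1)
  then obtain bs1 where bs1: "m = length bs1"
    "trace S 0 (arr s aF) (arr s aG) (arr s aH) (reg s1 rPb) bs1"
    "emitted s1 @ block_word bs1 = emitted s @ block_word bs"
    "c1 + 7 * m + 3 * length (block_word bs1) = c + 7 * length bs + 3 * length (block_word bs)"
    and s1: "arr s1 = arr s" "reg s1 rZero = 0" "reg s1 rOne = 1" "0 < reg s1 rPb"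
    by auto
  from bs1(2) show ?case
  proof cases
    case Nil
    with s1 show ?thesis by simp
  next
    case (Cons i bs2)
    from bs1 Cons s1 show ?thesis
      unfolding output_body_def
      apply (simp add: run_simps I)
      apply (rule run_emit_loop)
        apply (simp_all add: run_simps)
      apply (intro exI[of _ "length bs2"] conjI exI[of _ bs2])
          apply simp_all
      done
  qed
next
  case (3 m c1 s1)
  then obtain bs1 where "trace S 0 (arr s aF) (arr s aG) (arr s aH) 0 bs1"
    "emitted s1 @ block_word bs1 = emitted s @ block_word bs"
    "c1 + 7 * length bs1 + 3 * length (block_word bs1)
      = c + 7 * length bs + 3 * length (block_word bs)"
    by auto
  then show ?case
    by (cases rule: trace.cases) auto
qed

lemma length_blocks_le: "LD_blocks bs \<Longrightarrow> length bs \<le> length (block_word bs)"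
proof (induction bs)
  case (Cons b bs)
  then show ?case by (cases b) (auto simp: LD_blocks_Cons)
qed simp

lemma run_LDS_program:
  assumes I: "I = LDS_input A S w" and A: "set S \<subseteq> A"
  shows "run I LDS_program 0 init_state (\<lambda>t s. t \<le> length S * (12 * length S + 27) + 5 \<and>
    (\<exists>bs. max_weight_LDS w S bs \<and> emitted s = block_word bs))"
proof -
  have input: "inp_string I = S"
    by (simp add: I LDS_input_def)
  let ?s = "init_state\<lparr>reg := (\<lambda>_. 0)(rN := length S, rOne := 1, rI := length S)\<rparr>"
  \<comment> \<open>No position is filled yet, so the tables are vacuously correct and the initial
    zeros encode the empty LDS.\<close>
  have "fill_inv S w (length S) ?s"
    by (auto simp: fill_inv_def init_state_def tables_ok_def best_from_def)
  note fill = run_fill_loop[OF I A this, of 3]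
  have "run I (While (Less rZero rI) fill_body) 3 ?s (\<lambda>c s.
    run I (While (Less rZero rPb) output_body) c s (\<lambda>t s.
      t \<le> length S * (12 * length S + 27) + 5 \<and>
      (\<exists>bs. max_weight_LDS w S bs \<and> emitted s = block_word bs)))"
  proof (rule run_mono[OF fill], goal_cases)
    case (1 c s)
    then have s: "reg s rZero = 0" "reg s rOne = 1" "emitted s = []"
      and "tables_ok S w 0 (warr s aE) (warr s aV) (arr s aF) (arr s aG) (arr s aH)"
      "best_from (length S) (warr s aE) 0 (wreg s wB) (reg s rPb)"
      by (auto simp: fill_inv_def)
    then obtain bs where opt: "max_weight_LDS w S bs"
      and tr: "trace S 0 (arr s aF) (arr s aG) (arr s aH) (reg s rPb) bs"
      using max_weight_LDS_trace by blast
    have "length (block_word bs) \<le> length S" "length bs \<le> length (block_word bs)"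
      using opt length_blocks_le by (auto simp: max_weight_LDS_def LDS_def list_emb_length)
    \<comment> \<open>The output has at most \<open>length S\<close> letters and at most as many
      blocks, which adds 7 + 3 to the linear coefficient 17.\<close>
    with 1 have "c + 7 * length bs + 3 * length (block_word bs) + 1
        \<le> length S * (12 * length S + 27) + 5"
      by (simp add: algebra_simps)
    with opt s(3) show ?case
      by (intro run_mono[OF run_output_loop[OF input s(1,2) tr]]) auto
  qed
  then show ?thesis
    unfolding LDS_program_def
    by (simp add: run_simps input init_state_def eval_nat_numeral)
qed

theorem theorem3:
  "\<exists>(P :: program) (T :: nat \<Rightarrow> nat).
     (\<lambda>n. real (T n)) \<in> O(\<lambda>n. (real n)\<^sup>2) \<and>
     (\<forall>(A :: nat set) (S :: nat list) (w :: nat \<Rightarrow> nat \<Rightarrow> real).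
        finite A \<longrightarrow> set S \<subseteq> A \<longrightarrow> (\<forall>x\<in>A. \<forall>l\<in>{1..max_occ S}. 0 < w x l) \<longrightarrow>
        (\<exists>t s bs. exec (LDS_input A S w) P init_state t s \<and> t \<le> T (length S) \<and>
                  max_weight_LDS w S bs \<and> emitted s = block_word bs))"
proof (intro exI[of _ LDS_program] exI[of _ "\<lambda>n. n * (12 * n + 27) + 5"] conjI allI impI)
  let ?T = "\<lambda>n :: nat. n * (12 * n + 27) + 5"
  show "(\<lambda>n. real (?T n)) \<in> O(\<lambda>n. (real n)\<^sup>2)"
  \<comment> \<open>For \<open>n\<close> at least 1, every term is bounded by a multiple of the
    square, and 12 + 27 + 5 = 44.\<close>
  proof (rule bigoI[of _ 44], rule eventually_sequentiallyI[of 1])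
    fix n :: nat
    assume "1 \<le> n"
    then have "n \<le> n * n" "1 \<le> n * n"
      by simp_all
    then have "?T n \<le> 44 * (n * n)"
      unfolding distrib_left mult.left_commute[of n 12] mult.commute[of n 27] by linarith
    then have "real (?T n) \<le> real (44 * (n * n))"
      by (rule of_nat_mono)
    then show "norm (real (?T n)) \<le> 44 * norm ((real n)\<^sup>2)"
      by (simp add: power2_eq_square)
  qed
  fix A :: "nat set" and S :: "nat list" and w :: "nat \<Rightarrow> nat \<Rightarrow> real"
  assume "set S \<subseteq> A"
  from run_LDS_program[OF refl this, of w]
  show "\<exists>t s bs. exec (LDS_input A S w) LDS_program init_state t s \<and> t \<le> ?T (length S) \<and>
      max_weight_LDS w S bs \<and> emitted s = block_word bs"
    unfolding run_def by auto
qed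

end
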